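(* Let $s\ge0$ be an integer, $h\in\mathbb C\setminus\{0\}$ and $q\in\mathbb C\setminus\{0,1\}$. For all $0\le k\le n$, $$S_{s,h,q}[n,k]=h^{n-k}(1-q)^{k-n}\sum_{k\le t_1\le t_2\le t_3\le n}(-1)^{t_3-t_2+t_1-k}\,q^{(s-1)\binom{t_1-k}2-(s-1)\binom{t_1}2+s\binom{t_3}2}\binom{t_3}{t_2}\binom{t_2}{t_1}\genfrac{[}{]}{0pt}{}{n}{t_3}_{q^s}\genfrac{[}{]}{0pt}{}{t_1}{k}_{q^{s-1}}.$$
   Context: For an integer $x$, $[x]_q=\frac{q^x-1}{q-1}$ for $q\ne1$ (and $[x]_1=x$). The numbers $S_{s,h,q}[n,k]$ are the coefficients in $(VU)^n=\sum_{k=0}^nS_{s,h,q}[n,k]V^{sn-(s-1)k}U^k$, where $UV-qVU=hV^s$; equivalently they are determined by $S_{s,h,q}[n,k]=q^{s(n-1)-(s-1)(k-1)}S_{s,h,q}[n-1,k-1]+h[s(n-1)-(s-1)k]_q\,S_{s,h,q}[n-1,k]$ for $n,k\ge1$, with $S_{s,h,q}[n,0]=S_{s,h,q}[0,n]=\delta_{0,n}$. For $0\le k\le n$, $\genfrac{[}{]}{0pt}{}{n}{k}_p$ is the Gaussian ($p$-binomial) coefficient $\frac{[n]_p!}{[k]_p!\,[n-k]_p!}$, with $[n]_p!=[n]_p[n-1]_p\cdots[1]_p$, understood as a polynomial in $p$ evaluated at the given value (so it is the ordinary binomial coefficient at $p=1$). *)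

theory Defs
  imports Complex_Main "HOL-Computational_Algebra.Polynomial"
begin

definition q_bracket :: "complex \<Rightarrow> int \<Rightarrow> complex" where
  "q_bracket q x = (if q = 1 then of_int x else (q powi x - 1) / (q - 1))"

text \<open>
  The generalized Stirling numbers \<open>S\<^bsub>s,h,q\<^esub>[n, k]\<close>. At
  \<open>(Suc n, Suc k)\<close> the usual exponent \<open>s (n - 1) - (s - 1) (k - 1)\<close> reads
  \<open>s n - (s - 1) k\<close>. The exponents are integers: \<open>s - 1\<close> is negative for \<open>s = 0\<close>, and the argument
  of the bracket can be negative unless \<open>k < n\<close>.
\<close>

fun gen_stirling :: "nat \<Rightarrow> complex \<Rightarrow> complex \<Rightarrow> nat \<Rightarrow> nat \<Rightarrow> complex" where
  "gen_stirling s h q 0 0 = 1"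
| "gen_stirling s h q 0 (Suc k) = 0"
| "gen_stirling s h q (Suc n) 0 = 0"
| "gen_stirling s h q (Suc n) (Suc k) =
     q powi (int s * int n - (int s - 1) * int k) * gen_stirling s h q n k
     + h * q_bracket q (int s * int n - (int s - 1) * int (Suc k)) * gen_stirling s h q n (Suc k)"

lemma gen_stirling_eq_0: "n < k \<Longrightarrow> gen_stirling s h q n k = 0"
  by (induction s h q n k rule: gen_stirling.induct) auto

lemma q_bracket_Suc: "q_bracket q (int (Suc a)) = q ^ a + q_bracket q (int a)"
  by (auto simp: q_bracket_def field_simps power_int_def nat_add_distrib)

text \<open>
  The recurrence yields the normal ordering coefficients of \<open>(V U)\<^sup>n\<close> in every complex
  algebra (with structure map \<open>\<iota>\<close>) whose elements \<open>U\<close>, \<open>V\<close> satisfy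
  \<open>U V - q V U = h V\<^sup>s\<close>. Note \<open>s n - (s - 1) k = s (n - k) + k\<close> for \<open>k \<le> n\<close>.
\<close>

lemma VU_times_V_power:
  fixes \<iota> :: "complex \<Rightarrow> 'a::ring_1" and U V :: 'a
  assumes add: "\<And>a b. \<iota> (a + b) = \<iota> a + \<iota> b"
    and mult: "\<And>a b. \<iota> (a * b) = \<iota> a * \<iota> b"
    and one: "\<iota> 1 = 1"
    and central: "\<And>a x. \<iota> a * x = x * \<iota> a"
    and comm: "U * V - \<iota> q * V * U = \<iota> h * V ^ s"
  shows "V * U * V ^ a = \<iota> (q ^ a) * V ^ Suc a * U + \<iota> (h * q_bracket q (int a)) * V ^ (a + s)"
proof (induction a)
  case 0
  have "\<iota> 0 = 0" using add[of 0 0] by simp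
  then show ?case by (simp add: one q_bracket_def)
next
  case (Suc a)
  have UV: "U * V = \<iota> q * V * U + \<iota> h * V ^ s"
    using comm by (simp add: algebra_simps)
  have c: "V ^ m * (\<iota> b * x) = \<iota> b * (V ^ m * x)" for m b x
    using central[of b "V ^ m"] by (metis mult.assoc)
  have v: "V ^ m * (V * x) = V * (V ^ m * x)" for m x
    by (metis mult.assoc power_commutes)
  have v': "V ^ m * V = V * V ^ m" for m
    by (rule power_commutes)
  have "V * U * V ^ Suc a = (V * U * V ^ a) * V"
    by (simp add: power_commutes mult.assoc)
  also have "\<dots> = \<iota> (q ^ a) * V ^ Suc a * (U * V)
      + \<iota> (h * q_bracket q (int a)) * (V ^ (a + s) * V)"
    unfolding Suc by (simp add: algebra_simps)
  also have "\<dots> = \<iota> (q ^ a) * (V ^ Suc a * (\<iota> q * (V * U)))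
      + \<iota> (q ^ a) * (V ^ Suc a * (\<iota> h * V ^ s))
      + \<iota> (h * q_bracket q (int a)) * (V ^ (a + s) * V)"
    unfolding UV by (simp add: distrib_left mult.assoc)
  also have "\<dots> = \<iota> (q ^ a) * \<iota> q * (V ^ Suc a * V * U)
      + (\<iota> (q ^ a) * \<iota> h + \<iota> (h * q_bracket q (int a))) * V ^ (Suc a + s)"
    unfolding c
    by (simp add: algebra_simps power_add v v')
  also have "\<iota> (q ^ a) * \<iota> q = \<iota> (q ^ Suc a)"
    by (simp add: mult.commute flip: mult)
  also have "\<iota> (q ^ a) * \<iota> h + \<iota> (h * q_bracket q (int a)) = \<iota> (h * q_bracket q (int (Suc a)))"
    unfolding q_bracket_Suc by (simp add: distrib_left mult.commute flip: add mult)
  finally show ?case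
    by (simp add: mult.assoc power_commutes)
qed

lemma gen_stirling_normal_ordering:
  fixes \<iota> :: "complex \<Rightarrow> 'a::ring_1" and U V :: 'a
  assumes add: "\<And>a b. \<iota> (a + b) = \<iota> a + \<iota> b"
    and mult: "\<And>a b. \<iota> (a * b) = \<iota> a * \<iota> b"
    and one: "\<iota> 1 = 1"
    and central: "\<And>a x. \<iota> a * x = x * \<iota> a"
    and comm: "U * V - \<iota> q * V * U = \<iota> h * V ^ s"
  shows "(V * U) ^ n = (\<Sum>k=0..n. \<iota> (gen_stirling s h q n k) * V ^ (s * (n - k) + k) * U ^ k)"
proof (induction n)
  case 0
  show ?case by (simp add: one)
next
  case (Suc n)
  let ?S = "gen_stirling s h q"
  let ?e = "\<lambda>k. s * (n - k) + k"
  let ?A = "\<lambda>k. \<iota> (q ^ ?e k * ?S n k) * V ^ Suc (?e k) * U ^ Suc k"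
  let ?B = "\<lambda>k. \<iota> (h * q_bracket q (int (?e k)) * ?S n k) * V ^ (?e k + s) * U ^ k"
  have z: "\<iota> 0 = 0" using add[of 0 0] by simp
  have scal: "V * (\<iota> b * x) = \<iota> b * (V * x)" "U * (\<iota> b * x) = \<iota> b * (U * x)"
    "V ^ m * (\<iota> b * x) = \<iota> b * (V ^ m * x)" for b m x
    using central[of b V] central[of b U] central[of b "V ^ m"] by (metis mult.assoc)+
  have scal': "\<iota> a * (\<iota> b * x) = \<iota> b * (\<iota> a * x)" for a b x
    by (metis mult mult.assoc mult.commute)
  have summand: "V * U * (\<iota> (?S n k) * V ^ ?e k * U ^ k) = ?A k + ?B k" for k
  proof -
    have "V * U * (\<iota> (?S n k) * V ^ ?e k * U ^ k) = \<iota> (?S n k) * (V * U * V ^ ?e k) * U ^ k"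
      by (simp add: mult.assoc scal)
    also have "\<dots> = ?A k + ?B k"
      unfolding VU_times_V_power[of \<iota>, OF add mult one central comm]
      by (simp add: distrib_left distrib_right mult.assoc mult scal scal')
    finally show ?thesis .
  qed
  have "(V * U) ^ Suc n = (\<Sum>k=0..n. ?A k) + (\<Sum>k=0..n. ?B k)"
    by (simp only: power_Suc Suc sum_distrib_left summand[unfolded power_Suc] sum.distrib)
  also have "(\<Sum>k=0..n. ?B k) = (\<Sum>k=0..Suc n. ?B k)"
    by (simp add: gen_stirling_eq_0 z)
  also have "\<dots> = ?B 0 + (\<Sum>k=0..n. ?B (Suc k))"
    by (simp only: sum.atLeast0_atMost_Suc_shift o_def)
  also have "?B 0 = 0"
    by (cases n) (simp_all add: z q_bracket_def)
  also have "0 + (\<Sum>k=0..n. ?B (Suc k)) = (\<Sum>k=0..n. ?B (Suc k))"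
    by simp
  also have "(\<Sum>k=0..n. ?A k) + (\<Sum>k=0..n. ?B (Suc k))
      = (\<Sum>k=0..n. \<iota> (?S (Suc n) (Suc k)) * V ^ (s * (n - k) + Suc k) * U ^ Suc k)"
    unfolding sum.distrib[symmetric]
  proof (rule sum.cong[OF refl])
    fix k assume "k \<in> {0..n}"
    then have k: "k \<le> n" by simp
    have e1: "int s * int n - (int s - 1) * int k = int (?e k)"
      using k by (auto simp: le_iff_add algebra_simps)
    show "?A k + ?B (Suc k)
        = \<iota> (?S (Suc n) (Suc k)) * V ^ (s * (n - k) + Suc k) * U ^ Suc k"
    proof (cases "k = n")
      case True
      then show ?thesis
        by (simp add: gen_stirling_eq_0 z power_int_def e1[unfolded True]) 
    next
      case False
      then have k': "Suc k \<le> n" using k by simp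
      then have e2: "int s * int n - (int s - 1) * int (Suc k) = int (?e (Suc k))"
        by (auto simp: le_iff_add algebra_simps)
      have e3: "?e (Suc k) + s = s * (n - k) + Suc k"
        using k' by (auto simp: le_iff_add algebra_simps Suc_diff_le)
      show ?thesis
        unfolding gen_stirling.simps e1 e2 e3
        by (simp add: add distrib_right power_int_def del: power_Suc of_nat_Suc of_nat_add)
    qed
  qed
  also have "\<dots> = (\<Sum>k=0..Suc n. \<iota> (?S (Suc n) k) * V ^ (s * (Suc n - k) + k) * U ^ k)"
    unfolding sum.atLeast0_atMost_Suc_shift o_def by (simp add: z del: gen_stirling.simps(4))
  finally show ?case .
qed

definition q_bracket_poly :: "nat \<Rightarrow> complex poly" where
  "q_bracket_poly n = (\<Sum>i<n. monom 1 i)"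

definition q_fact_poly :: "nat \<Rightarrow> complex poly" where
  "q_fact_poly n = (\<Prod>i=1..n. q_bracket_poly i)"

text \<open>
  The quotient is taken in the polynomial ring, where the division is exact
  (lemma \<open>q_fact_poly_dvd\<close>); so evaluation at roots of unity is meaningful.
\<close>

definition gauss_binomial_poly :: "nat \<Rightarrow> nat \<Rightarrow> complex poly" where
  "gauss_binomial_poly n k = q_fact_poly n div (q_fact_poly k * q_fact_poly (n - k))"

definition gauss_binomial :: "nat \<Rightarrow> nat \<Rightarrow> complex \<Rightarrow> complex" where
  "gauss_binomial n k p = poly (gauss_binomial_poly n k) p"

lemma poly_q_bracket_poly: "poly (q_bracket_poly n) p = q_bracket p (int n)"
  by (simp add: q_bracket_poly_def q_bracket_def poly_sum poly_monom power_int_def sum_gp_strict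
      divide_simps) (auto simp: algebra_simps)

lemma q_bracket_poly_add:
  "q_bracket_poly (m + n) = q_bracket_poly m + monom 1 m * q_bracket_poly n"
  by (induction n) (simp_all add: q_bracket_poly_def mult_monom algebra_simps)

lemma q_fact_poly_Suc: "q_fact_poly (Suc n) = q_bracket_poly (Suc n) * q_fact_poly n"
  by (simp add: q_fact_poly_def)

lemma q_fact_poly_dvd: "k \<le> n \<Longrightarrow> q_fact_poly k * q_fact_poly (n - k) dvd q_fact_poly n"
proof (induction n arbitrary: k)
  case 0
  then show ?case by (simp add: q_fact_poly_def)
next
  case (Suc n)
  show ?case
  proof (cases "k = 0 \<or> k = Suc n")
    case True
    then show ?thesis by (auto simp: q_fact_poly_def)
  next
    case False
    then obtain j where j: "k = Suc j" "j < n"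
      using Suc.prems by (cases k) auto
    have d: "Suc n - k = Suc (n - k)" "n - j = Suc (n - k)"
      using j by auto
    have "q_bracket_poly (Suc n) = q_bracket_poly k + monom 1 k * q_bracket_poly (Suc (n - k))"
      using q_bracket_poly_add[of k "Suc (n - k)"] j by simp
    then have eq: "q_fact_poly (Suc n) = q_bracket_poly k * q_fact_poly n
        + monom 1 k * (q_bracket_poly (Suc (n - k)) * q_fact_poly n)"
      by (simp add: q_fact_poly_Suc algebra_simps)
    have "q_fact_poly j * q_fact_poly (n - j) dvd q_fact_poly n"
      using Suc.IH[of j] j by simp
    then have "q_bracket_poly k * (q_fact_poly j * q_fact_poly (n - j))
        dvd q_bracket_poly k * q_fact_poly n"
      by (rule mult_dvd_mono[OF dvd_refl])
    then have 1: "q_fact_poly k * q_fact_poly (Suc n - k) dvd q_bracket_poly k * q_fact_poly n"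
      unfolding d by (simp add: j q_fact_poly_Suc mult.assoc)
    have "q_fact_poly k * q_fact_poly (n - k) dvd q_fact_poly n"
      using Suc.IH[of k] j by simp
    then have "q_bracket_poly (Suc (n - k)) * (q_fact_poly k * q_fact_poly (n - k))
        dvd q_bracket_poly (Suc (n - k)) * q_fact_poly n"
      by (rule mult_dvd_mono[OF dvd_refl])
    then have 2: "q_fact_poly k * q_fact_poly (Suc n - k)
        dvd q_bracket_poly (Suc (n - k)) * q_fact_poly n"
      unfolding d by (simp add: q_fact_poly_Suc mult.left_commute)
    show ?thesis
      unfolding eq by (intro dvd_add 1 dvd_mult 2)
  qed
qed

end

theory Submission
  imports Defs
begin

text \<open>
  Summing over \<open>t\<^sub>2\<close> first, binomial inversion forces \<open>t\<^sub>1 = t\<^sub>3\<close> and leaves a single sum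
  over \<open>t\<close>. With \<open>P = q\<^sup>s\<close> and \<open>R = q\<^bsup>s-1\<^esup>\<close> it has the form
  \<open>\<Sum>\<^sub>t c(t, k) P\<^bsup>t(t-1)/2\<^esup> [n, t]\<^sub>P\<close>, where \<open>c(t, k)\<close> depends on \<open>R\<close> only. The Pascal rule
  \<open>[n + 1, k + 1]\<^sub>p = [n, k + 1]\<^sub>p + p\<^bsup>n-k\<^esup> [n, k]\<^sub>p\<close>, used once with \<open>p = P\<close> in \<open>n\<close> and once with
  \<open>p = R\<close> in \<open>t\<close>, shows that this sum satisfies the recurrence of the Stirling numbers up to the
  factor \<open>(h / (1 - q))\<^bsup>n-k\<^esup>\<close>.
\<close>

text \<open>
  Unlike \<^const>\<open>gauss_binomial\<close>, which is \<open>1\<close> at \<open>(0, 1)\<close>, this vanishes for all \<open>k > n\<close>, so the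
  Pascal rule holds without side conditions.
\<close>

fun q_binomial :: "'a::comm_ring_1 \<Rightarrow> nat \<Rightarrow> nat \<Rightarrow> 'a" where
  "q_binomial p n 0 = 1"
| "q_binomial p 0 (Suc k) = 0"
| "q_binomial p (Suc n) (Suc k) = q_binomial p n (Suc k) + p ^ (n - k) * q_binomial p n k"

lemma q_binomial_eq_0: "n < k \<Longrightarrow> q_binomial p n k = 0"
  by (induction p n k rule: q_binomial.induct) auto

lemma q_binomial_self: "q_binomial p n n = 1"
  by (induction n) (simp_all add: q_binomial_eq_0)

lemma poly_q_binomial: "poly (q_binomial f n k) x = q_binomial (poly f x) n k"
  by (induction f n k rule: q_binomial.induct) auto

section \<open>Gaussian coefficients: Pascal rule versus factorial quotient\<close>

text \<open>Splitting [n+1] = [n-j] + X^(n-j) [j+1] yields the two Pascal terms.\<close>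

lemma q_fact_poly_eq_q_binomial:
  "k \<le> n \<Longrightarrow> q_fact_poly n = q_binomial (monom 1 1) n k * (q_fact_poly k * q_fact_poly (n - k))"
proof (induction n arbitrary: k)
  case 0
  then show ?case by (simp add: q_fact_poly_def)
next
  case (Suc n)
  show ?case
  proof (cases "k = 0 \<or> k = Suc n")
    case True
    then show ?thesis
      by (auto simp: q_binomial_self q_fact_poly_def simp del: q_binomial.simps(3))
  next
    case False
    then obtain j where j: "k = Suc j" "j < n"
      using Suc.prems by (cases k) auto
    let ?X = "monom 1 1 :: complex poly"
    have d: "n - j = Suc (n - Suc j)"
      using j by simp
    have "q_bracket_poly (Suc n) = q_bracket_poly (n - j) + monom 1 (n - j) * q_bracket_poly (Suc j)"
      using q_bracket_poly_add[of "n - j" "Suc j"] j by simp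
    then have "q_fact_poly (Suc n) = q_bracket_poly (n - j) * q_fact_poly n
        + ?X ^ (n - j) * q_bracket_poly (Suc j) * q_fact_poly n"
      by (simp add: q_fact_poly_Suc monom_power distrib_right)
    also have "q_bracket_poly (n - j) * q_fact_poly n
        = q_binomial ?X n (Suc j) * (q_fact_poly (Suc j) * q_fact_poly (n - j))"
      using Suc.IH[of "Suc j"] j by (simp add: d q_fact_poly_Suc mult_ac)
    also have "?X ^ (n - j) * q_bracket_poly (Suc j) * q_fact_poly n
        = ?X ^ (n - j) * q_binomial ?X n j * (q_fact_poly (Suc j) * q_fact_poly (n - j))"
      using Suc.IH[of j] j by (simp add: q_fact_poly_Suc mult_ac)
    finally show ?thesis
      using j by (simp add: distrib_right)
  qed
qed

text \<open>Each factor takes the nonzero value i at 1. So factorials cancel as polynomials, even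
  where their values vanish.\<close>

lemma q_fact_poly_nonzero: "q_fact_poly n \<noteq> 0"
proof -
  have "q_bracket_poly i \<noteq> 0" if "i \<ge> 1" for i
    using that poly_q_bracket_poly[of i 1] by (auto simp: q_bracket_def)
  then show ?thesis
    by (auto simp: q_fact_poly_def)
qed

lemma gauss_binomial_eq_q_binomial:
  assumes "k \<le> n"
  shows "gauss_binomial n k p = q_binomial p n k"
proof -
  have "gauss_binomial_poly n k = q_binomial (monom 1 1) n k"
    unfolding gauss_binomial_poly_def q_fact_poly_eq_q_binomial[OF assms]
    by (simp add: q_fact_poly_nonzero)
  then show ?thesis
    by (simp add: gauss_binomial_def poly_q_binomial poly_monom)
qed

section \<open>Change of basis between two bases p and r\<close>

text \<open>For r \<noteq> 0 these expand x^t in the products (1 + x)(1 + r x)...(1 + r^(k-1) x).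
  The sign exponent \<open>t + k\<close> avoids truncated subtraction.\<close>

definition q_inversion_coeff :: "'a::field \<Rightarrow> nat \<Rightarrow> nat \<Rightarrow> 'a" where
  "q_inversion_coeff r t k =
     (-1) ^ (t + k) * r powi (int ((t - k) choose 2) - int (t choose 2)) * q_binomial r t k"

lemma q_inversion_coeff_eq_0: "t < k \<Longrightarrow> q_inversion_coeff r t k = 0"
  by (simp add: q_inversion_coeff_def q_binomial_eq_0)

lemma choose_two_Suc: "Suc n choose 2 = n + (n choose 2)"
  by (simp add: numeral_2_eq_2)

lemma q_inversion_coeff_Suc_0: "q_inversion_coeff r (Suc t) 0 = - q_inversion_coeff r t 0"
  by (simp add: q_inversion_coeff_def)

text \<open>Reflects x = r^(-k) ((1 + r^k x) - 1), applied to x times the k-th product.\<close>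

lemma q_inversion_coeff_Suc_Suc:
  assumes r: "r \<noteq> 0"
  shows "q_inversion_coeff r (Suc t) (Suc k)
    = r powi (- int k) * q_inversion_coeff r t k
      - r powi (- int (Suc k)) * q_inversion_coeff r t (Suc k)"
proof (cases "t < k")
  case True
  then show ?thesis by (simp add: q_inversion_coeff_eq_0)
next
  case False
  let ?e = "int ((t - k) choose 2) - int (Suc t choose 2)"
  have "q_inversion_coeff r (Suc t) (Suc k) = (-1) ^ (t + k) * (r powi ?e * q_binomial r t (Suc k))
      + (-1) ^ (t + k) * (r powi ?e * r ^ (t - k)) * q_binomial r t k"
    by (simp add: q_inversion_coeff_def algebra_simps)
  also have "r powi ?e * r ^ (t - k) = r powi (?e + int (t - k))"
    using r by (simp add: power_int_add)
  also have "?e + int (t - k) = - int k + (int ((t - k) choose 2) - int (t choose 2))"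
    using False by (simp add: choose_two_Suc)
  also have "r powi \<dots> = r powi (- int k) * r powi (int ((t - k) choose 2) - int (t choose 2))"
    using r by (simp only: power_int_add simp_thms)
  also have "r powi ?e * q_binomial r t (Suc k) = r powi (- int (Suc k))
      * r powi (int ((t - Suc k) choose 2) - int (t choose 2)) * q_binomial r t (Suc k)"
  \<comment> \<open>At t = k truncation of \<open>t - Suc k\<close> breaks the exponent identity,
    but the binomial factor is 0.\<close>
  proof (cases "t = k")
    case True
    then show ?thesis by (simp add: q_binomial_eq_0)
  next
    case ne: False
    then have "t - k = Suc (t - Suc k)"
      using False by simp
    then have "?e = - int (Suc k) + (int ((t - Suc k) choose 2) - int (t choose 2))"
      using False ne by (simp add: choose_two_Suc)
    then show ?thesis
      using r by (simp only: power_int_add simp_thms)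
  qed
  finally show ?thesis
    by (simp add: q_inversion_coeff_def mult_ac)
qed

text \<open>By the q-binomial theorem and for r \<noteq> 0, the coefficients of (1 + x)(1 + p
  x)...(1 + p^(n-1) x) in the corresponding base-r products.\<close>

definition two_base_sum :: "'a::field \<Rightarrow> 'a \<Rightarrow> nat \<Rightarrow> nat \<Rightarrow> 'a" where
  "two_base_sum p r n k =
     (\<Sum>t\<le>n. q_inversion_coeff r t k * p ^ (t choose 2) * q_binomial p n t)"

text \<open>After the shift to t + 1, the weight contributes an extra p^t, which completes the
  Pascal factor p^(n-t) to p^n, free of t.\<close>

lemma two_base_sum_Suc_left:
  "two_base_sum p r (Suc n) k = two_base_sum p r n k
     + p ^ n * (\<Sum>t\<le>n. q_inversion_coeff r (Suc t) k * p ^ (t choose 2) * q_binomial p n t)"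
proof -
  let ?f = "\<lambda>t. q_inversion_coeff r t k * p ^ (t choose 2)"
  have "two_base_sum p r (Suc n) k = ?f 0 * q_binomial p n 0
      + (\<Sum>t\<le>n. ?f (Suc t) * q_binomial p n (Suc t) + ?f (Suc t) * p ^ (n - t) * q_binomial p n t)"
    by (simp add: two_base_sum_def sum.atMost_Suc_shift distrib_left mult.assoc
        del: sum.atMost_Suc)
  also have "\<dots> = (\<Sum>t\<le>Suc n. ?f t * q_binomial p n t)
      + (\<Sum>t\<le>n. ?f (Suc t) * p ^ (n - t) * q_binomial p n t)"
    by (simp add: sum.distrib sum.atMost_Suc_shift del: sum.atMost_Suc)
  also have "(\<Sum>t\<le>Suc n. ?f t * q_binomial p n t) = two_base_sum p r n k"
    by (simp add: two_base_sum_def q_binomial_eq_0)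
  also have "(\<Sum>t\<le>n. ?f (Suc t) * p ^ (n - t) * q_binomial p n t)
      = p ^ n * (\<Sum>t\<le>n. q_inversion_coeff r (Suc t) k * p ^ (t choose 2) * q_binomial p n t)"
    unfolding sum_distrib_left
  proof (rule sum.cong[OF refl])
    fix t assume "t \<in> {..n}"
    then have "p ^ n = p ^ t * p ^ (n - t)"
      by (simp flip: power_add)
    then show "?f (Suc t) * p ^ (n - t) * q_binomial p n t
        = p ^ n * (q_inversion_coeff r (Suc t) k * p ^ (t choose 2) * q_binomial p n t)"
      by (simp add: choose_two_Suc power_add mult_ac)
  qed
  finally show ?thesis .
qed

lemma two_base_sum_0: "two_base_sum p r 0 k = (if k = 0 then 1 else 0)"
  by (auto simp: two_base_sum_def q_inversion_coeff_eq_0) (simp add: q_inversion_coeff_def numeral_2_eq_2)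

text \<open>Each step multiplies by 1 - p^n, which is 0 at n = 0.\<close>

lemma two_base_sum_Suc_0: "two_base_sum p r (Suc n) 0 = 0"
proof -
  have "two_base_sum p r (Suc n) 0 = (1 - p ^ n) * two_base_sum p r n 0" for n
    unfolding two_base_sum_Suc_left
    by (simp add: two_base_sum_def q_inversion_coeff_Suc_0 sum_negf algebra_simps)
  then show ?thesis
    by (induction n) simp_all
qed

text \<open>Reflects 1 + p^n x = p^n r^(-k) (1 + r^k x) + (1 - p^n r^(-k)).\<close>

lemma two_base_sum_Suc_Suc:
  assumes "r \<noteq> 0"
  shows "two_base_sum p r (Suc n) (Suc k) = p ^ n * r powi (- int k) * two_base_sum p r n k
    + (1 - p ^ n * r powi (- int (Suc k))) * two_base_sum p r n (Suc k)"
  unfolding two_base_sum_Suc_left q_inversion_coeff_Suc_Suc[OF assms]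
  by (simp add: two_base_sum_def left_diff_distrib sum_subtractf right_diff_distrib
      sum_distrib_left mult_ac)

section \<open>Matching the Stirling recurrence\<close>

lemma gen_stirling_eq_two_base_sum:
  assumes q: "q \<noteq> 0" "q \<noteq> 1"
  shows "k \<le> n \<Longrightarrow> gen_stirling s h q n k
    = (h / (1 - q)) ^ (n - k) * two_base_sum (q ^ s) (q powi (int s - 1)) n k"
proof (induction n arbitrary: k)
  case 0
  then show ?case by (simp add: two_base_sum_0)
next
  case (Suc n)
  let ?T = "two_base_sum (q ^ s) (q powi (int s - 1))" and ?z = "h / (1 - q)"
  show ?case
  proof (cases k)
    case 0
    then show ?thesis by (simp add: two_base_sum_Suc_0)
  next
    case k: (Suc j)
    let ?w = "\<lambda>i. (q ^ s) ^ n * (q powi (int s - 1)) powi (- int i)"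
    have w: "q powi (int s * int n - (int s - 1) * int i) = ?w i" for i
    proof -
      have "(q powi (int s - 1)) powi (- int i) = q powi (- ((int s - 1) * int i))"
        by (simp flip: power_int_mult)
      moreover have "(q ^ s) ^ n = q powi (int s * int n)"
        by (simp add: power_int_mult)
      ultimately show ?thesis
        using q by (simp flip: power_int_add)
    qed
    have b: "h * q_bracket q (int s * int n - (int s - 1) * int i) = ?z * (1 - ?w i)" for i
      using q by (simp add: q_bracket_def w divide_simps) (simp add: algebra_simps)
    \<comment> \<open>The bracket supplies the extra \<open>?z\<close>, giving both terms the power
      \<open>n - j\<close>; at j = n both sides are 0.\<close>
    have "?z * gen_stirling s h q n (Suc j) = ?z ^ (n - j) * ?T n (Suc j)"
    proof (cases "j < n")
      case True
      then have "n - j = Suc (n - Suc j)" by simp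
      then show ?thesis using True Suc.IH[of "Suc j"] by simp
    next
      case False
      then show ?thesis
        by (simp add: gen_stirling_eq_0 two_base_sum_def q_inversion_coeff_eq_0)
    qed
    moreover have "gen_stirling s h q n j = ?z ^ (n - j) * ?T n j"
      using Suc k by simp
    moreover have "gen_stirling s h q (Suc n) (Suc j)
        = ?w j * gen_stirling s h q n j + (1 - ?w (Suc j)) * (?z * gen_stirling s h q n (Suc j))"
      unfolding gen_stirling.simps b w by (simp only: mult_ac)
    moreover have "?T (Suc n) (Suc j) = ?w j * ?T n j + (1 - ?w (Suc j)) * ?T n (Suc j)"
      using q by (intro two_base_sum_Suc_Suc) simp
    ultimately show ?thesis
      unfolding k by (simp only: diff_Suc_Suc distrib_left mult_ac)
  qed
qed

section \<open>Binomial inversion and collapse of the triple sum\<close>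

text \<open>C(n,j) C(j,m) = C(n,m) C(n-m,n-j) reduces this to an alternating row sum of
  binomials.\<close>

lemma alternating_sum_choose_mult_choose:
  assumes "m \<le> n"
  shows "(\<Sum>j=m..n. (-1) ^ (n - j) * of_nat (n choose j) * of_nat (j choose m))
    = (if m = n then 1 else 0 :: 'a::comm_ring_1)"
proof -
  have "(\<Sum>j=m..n. (-1) ^ (n - j) * of_nat (n choose j) * of_nat (j choose m))
      = (\<Sum>i\<le>n - m. (-1) ^ i * of_nat (n choose m) * of_nat ((n - m) choose i) :: 'a)"
  proof (rule sum.reindex_bij_witness[of _ "\<lambda>i. n - i" "\<lambda>j. n - j"])
    fix j assume j: "j \<in> {m..n}"
    then have "(n - m) choose (j - m) = (n - m) choose (n - j)"
      using binomial_symmetric[of "j - m" "n - m"] by (simp add: diff_le_mono)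
    then have "(n choose j) * (j choose m) = (n choose m) * ((n - m) choose (n - j))"
      using j choose_mult[of m j n] by simp
    then have "of_nat (n choose j) * of_nat (j choose m)
        = (of_nat (n choose m) * of_nat ((n - m) choose (n - j)) :: 'a)"
      by (metis of_nat_mult)
    then show "(-1) ^ (n - j) * of_nat (n choose m) * of_nat ((n - m) choose (n - j))
        = ((-1) ^ (n - j) * of_nat (n choose j) * of_nat (j choose m) :: 'a)"
      by (simp add: mult.assoc)
  qed (use assms in auto)
  also have "\<dots> = of_nat (n choose m) * (\<Sum>i\<le>n - m. (-1) ^ i * of_nat ((n - m) choose i))"
    by (simp add: sum_distrib_left mult_ac)
  also have "\<dots> = (if m = n then 1 else 0)"
    using assms choose_alternating_sum[of "n - m", where 'a = 'a] by auto
  finally show ?thesis .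
qed

text \<open>Exchanging the triangular sums leaves an inner sum over j that vanishes unless m =
  a.\<close>

lemma binomial_inversion_sum:
  fixes g :: "nat \<Rightarrow> 'a::comm_ring_1"
  assumes "a \<le> n"
  shows "(\<Sum>j=a..n. \<Sum>m=j..n. (-1) ^ (m - j) * of_nat (m choose j) * of_nat (j choose a) * g m)
    = g a"
proof -
  let ?f = "\<lambda>j m. (-1) ^ (m - j) * of_nat (m choose j) * of_nat (j choose a) :: 'a"
  have "(\<Sum>j=a..n. \<Sum>m=j..n. ?f j m * g m) = (\<Sum>m=a..n. \<Sum>j=a..m. ?f j m * g m)"
    by (simp add: sum.Sigma)
      (rule sum.reindex_bij_witness[of _ "\<lambda>(x, y). (y, x)" "\<lambda>(x, y). (y, x)"]; auto)
  also have "\<dots> = (\<Sum>m=a..n. if a = m then g m else 0)"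
    by (intro sum.cong refl)
      (simp add: alternating_sum_choose_mult_choose flip: sum_distrib_right)
  also have "\<dots> = g a"
    using assms by simp
  finally show ?thesis .
qed

theorem corollary8:
  fixes s n k :: nat and h q :: complex
  assumes "h \<noteq> 0" and "q \<noteq> 0" and "q \<noteq> 1" and "k \<le> n"
  shows "gen_stirling s h q n k =
    h ^ (n - k) * (1 - q) powi (int k - int n) *
    (\<Sum>t1=k..n. \<Sum>t2=t1..n. \<Sum>t3=t2..n.
       (-1) ^ ((t3 - t2) + (t1 - k))
       * q powi ((int s - 1) * int ((t1 - k) choose 2)
                 - (int s - 1) * int (t1 choose 2)
                 + int s * int (t3 choose 2))
       * of_nat (t3 choose t2) * of_nat (t2 choose t1)
       * gauss_binomial n t3 (q ^ s)
       * gauss_binomial t1 k (q powi (int s - 1)))"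
    (is "_ = _ * (\<Sum>t1=k..n. \<Sum>t2=t1..n. \<Sum>t3=t2..n. ?f t1 t2 t3)")
proof -
  let ?P = "q ^ s" and ?R = "q powi (int s - 1)"
  have inner: "(\<Sum>t2=t1..n. \<Sum>t3=t2..n. ?f t1 t2 t3)
      = q_inversion_coeff ?R t1 k * ?P ^ (t1 choose 2) * q_binomial ?P n t1"
    if t1: "t1 \<in> {k..n}" for t1
  proof -
    \<comment> \<open>\<open>t2\<close> occurs only in the sign and the ordinary binomials; for
      fixed \<open>t1\<close>, \<open>?g\<close> collects the rest as a function of
      \<open>t3\<close>.\<close>
    let ?g = "\<lambda>t. q_inversion_coeff ?R t1 k * ?P ^ (t choose 2) * q_binomial ?P n t"
    have "(\<Sum>t2=t1..n. \<Sum>t3=t2..n. ?f t1 t2 t3) = (\<Sum>t2=t1..n. \<Sum>t3=t2..n.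
        (-1) ^ (t3 - t2) * of_nat (t3 choose t2) * of_nat (t2 choose t1) * ?g t3)"
    proof (intro sum.cong refl)
      fix t2 t3 assume t: "t2 \<in> {t1..n}" "t3 \<in> {t2..n}"
      have "q powi ((int s - 1) * int ((t1 - k) choose 2) - (int s - 1) * int (t1 choose 2)
            + int s * int (t3 choose 2))
          = q powi ((int s - 1) * (int ((t1 - k) choose 2) - int (t1 choose 2)))
            * q powi (int s * int (t3 choose 2))"
        using assms by (simp add: right_diff_distrib flip: power_int_add)
      also have "\<dots> = ?R powi (int ((t1 - k) choose 2) - int (t1 choose 2)) * ?P ^ (t3 choose 2)"
        by (simp add: power_int_mult)
      finally have e: "q powi ((int s - 1) * int ((t1 - k) choose 2)
          - (int s - 1) * int (t1 choose 2) + int s * int (t3 choose 2)) = \<dots>" .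
      have sgn: "(-1) ^ (t1 - k) = ((-1) ^ (t1 + k) :: complex)"
        using t1 by (simp add: minus_one_power_iff)
      show "?f t1 t2 t3 = (-1) ^ (t3 - t2) * of_nat (t3 choose t2) * of_nat (t2 choose t1) * ?g t3"
        unfolding e power_add[of _ "t3 - t2"] sgn
        using t t1
        by (simp add: gauss_binomial_eq_q_binomial q_inversion_coeff_def mult_ac)
    qed
    also have "\<dots> = ?g t1"
      using t1 by (intro binomial_inversion_sum) simp
    finally show ?thesis .
  qed
  have "(\<Sum>t1=k..n. \<Sum>t2=t1..n. \<Sum>t3=t2..n. ?f t1 t2 t3)
      = (\<Sum>t\<in>{k..n}. q_inversion_coeff ?R t k * ?P ^ (t choose 2) * q_binomial ?P n t)"
    by (intro sum.cong refl inner)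
  \<comment> \<open>The added indices t < k contribute 0.\<close>
  also have "\<dots> = two_base_sum ?P ?R n k"
    unfolding two_base_sum_def
    by (rule sum.mono_neutral_left) (auto simp: q_inversion_coeff_eq_0)
  finally have "(\<Sum>t1=k..n. \<Sum>t2=t1..n. \<Sum>t3=t2..n. ?f t1 t2 t3) = two_base_sum ?P ?R n k" .
  moreover have "(1 - q) powi (int k - int n) = inverse ((1 - q) ^ (n - k))"
    using \<open>k \<le> n\<close> by (simp add: power_int_def power_inverse) (simp add: nat_diff_distrib')
  ultimately show ?thesis
    using gen_stirling_eq_two_base_sum[of q k n s h] assms
    by (simp only: power_divide divide_inverse power_mult_distrib power_inverse simp_thms)
qed

end
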